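(* Consider massless QED in momentum scheme, and let $\gamma_1(\alpha)$ and $\gamma_2(\alpha)$ be the first and second log-coefficient functions of the photon Green's function $G(\alpha,L)=1-\sum_{k\ge1}\gamma_k(\alpha)L^k$, where $\alpha>0$ is the coupling. QED has a Landau pole if $\gamma_1(\alpha)<2\gamma_2(\alpha)$ for large enough $\alpha>0$. A necessary condition for the non-existence of a Landau pole therefore is given by $$\gamma_1(\alpha)\ \geq\ 2\gamma_2(\alpha)\qquad\text{for sufficiently large }\alpha,$$ i.e. the second log-coefficient function must not win out over the first.
   Context: Here $L=\ln(-q^2/\mu^2)$ with photon momentum $q$ and renormalization point $\mu^2$. $G(\alpha,L)$ is the form factor in the denominator of the transversal part of the full renormalized photon propagator, normalized by $G(\alpha,0)=1$. The function $\gamma(\alpha):=\gamma_1(\alpha)$ is the anomalous dimension of the photon, and $\beta(\alpha):=\alpha\gamma(\alpha)$ is the $\beta$-function. The Callan-Symanzik equation $(-\partial_L+\beta(\alpha)\partial_\alpha-\gamma(\alpha))G(\alpha,L)=0$ implies the recursion $(k+1)\gamma_{k+1}(\alpha)=\gamma(\alpha)(\alpha\partial_\alpha-1)\gamma_k(\alpha)$ for $k\ge1$; in particular $2\gamma_2(\alpha)=\gamma(\alpha)(\alpha\gamma'(\alpha)-\gamma(\alpha))$. Put $P(\alpha):=\gamma_1(\alpha)-2\gamma_2(\alpha)$, so that $\gamma(\alpha)+\gamma(\alpha)(1-\alpha\partial_\alpha)\gamma(\alpha)=P(\alpha)$. Standing assumptions: the functions are smooth enough for these equations to make sense on $(0,\infty)$;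 $\beta(\alpha)>0$ and $P(\alpha)>0$ for small $\alpha>0$; and $P$ does not have infinitely many zeros. Landau pole: the running coupling $\alpha(L)$ is the solution of $\partial_L\alpha(L)=\beta(\alpha(L))$ with $\alpha(L_0)=\alpha_0>0$, so that $L-L_0=\int_{\alpha_0}^{\alpha(L)}\frac{dx}{\beta(x)}$. There is a Landau pole if $\alpha(L)$ diverges at a finite value of $L$, which is the case when the integral $\int_{\alpha_0}^{\infty}\frac{dx}{\beta(x)}$ converges (if $\beta$ has zeros, $\alpha_0$ is chosen beyond them); avoiding a Landau pole means that this integral diverges.
   Formalization: Adds the assumption that β(α) is not negative for all large α; without it the claim fails, e.g. for γ₁=α(1−α)/(1+2α²), where γ₁<2γ₂ for large α but the integral of 1/β diverges, so there is no Landau pole. *)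

theory Defs
  imports "HOL-Analysis.Analysis"
begin

text \<open>
  \<open>G \<alpha> L\<close> is the form factor of the photon propagator and \<open>\<gamma> k\<close> (for \<open>k \<ge> 1\<close>) its
  \<open>k\<close>-th log-coefficient function; \<open>\<gamma> 0\<close> is never used. Only couplings \<open>\<alpha> > 0\<close> matter.
  The expansion in \<open>L\<close> is required near \<open>L = 0\<close> only, with a radius that may depend on \<open>\<alpha>\<close>.
\<close>

definition log_expansion :: "(real \<Rightarrow> real \<Rightarrow> real) \<Rightarrow> (nat \<Rightarrow> real \<Rightarrow> real) \<Rightarrow> bool" where
  "log_expansion G \<gamma> \<longleftrightarrow>
     (\<forall>\<alpha>>0. \<forall>\<^sub>F L in nhds 0. (\<lambda>k. \<gamma> (Suc k) \<alpha> * L ^ Suc k) sums (1 - G \<alpha> L))"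

text \<open>
  The regularity needed to compare coefficients of powers of \<open>L\<close> in the Callan--Symanzik
  equation: the log-coefficient functions are differentiable in \<open>\<alpha>\<close>, and so is \<open>G\<close>, with its
  expansion differentiable term by term.
\<close>

definition smooth_log_expansion :: "(real \<Rightarrow> real \<Rightarrow> real) \<Rightarrow> (nat \<Rightarrow> real \<Rightarrow> real) \<Rightarrow> bool" where
  "smooth_log_expansion G \<gamma> \<longleftrightarrow>
     (\<forall>\<alpha>>0. (\<forall>k\<ge>1. \<gamma> k field_differentiable at \<alpha>) \<and>
       (\<forall>\<^sub>F L in nhds 0. (\<lambda>a. G a L) field_differentiable at \<alpha> \<and>
          (\<lambda>k. deriv (\<gamma> (Suc k)) \<alpha> * L ^ Suc k) sums (- deriv (\<lambda>a. G a L) \<alpha>)))"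

definition beta_function :: "(nat \<Rightarrow> real \<Rightarrow> real) \<Rightarrow> real \<Rightarrow> real" where
  "beta_function \<gamma> \<alpha> = \<alpha> * \<gamma> 1 \<alpha>"

definition callan_symanzik :: "(real \<Rightarrow> real \<Rightarrow> real) \<Rightarrow> (nat \<Rightarrow> real \<Rightarrow> real) \<Rightarrow> bool" where
  "callan_symanzik G \<gamma> \<longleftrightarrow>
     (\<forall>\<alpha>>0. \<forall>\<^sub>F L in nhds 0.
        - deriv (\<lambda>l. G \<alpha> l) L + beta_function \<gamma> \<alpha> * deriv (\<lambda>a. G a L) \<alpha> - \<gamma> 1 \<alpha> * G \<alpha> L = 0)"

definition running_coupling ::
  "(real \<Rightarrow> real) \<Rightarrow> real \<Rightarrow> real \<Rightarrow> real set \<Rightarrow> (real \<Rightarrow> real) \<Rightarrow> bool" where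
  "running_coupling \<beta> L\<^sub>0 \<alpha>\<^sub>0 I a \<longleftrightarrow>
     L\<^sub>0 \<in> I \<and> a L\<^sub>0 = \<alpha>\<^sub>0 \<and>
     (\<forall>L\<in>I. a L > 0 \<and> (a has_real_derivative \<beta> (a L)) (at L within I))"

text \<open>
  The running coupling, started beyond all zeros of \<open>\<beta>\<close>, diverges at a finite value \<open>L\<^sub>p\<close> of \<open>L\<close>.
  The half-open segment from \<open>L\<^sub>0\<close> to \<open>L\<^sub>p\<close> does not prescribe on which side of \<open>L\<^sub>0\<close> the pole lies;
  for \<open>\<beta> > 0\<close> beyond \<open>\<alpha>\<^sub>0\<close> necessarily \<open>L\<^sub>p > L\<^sub>0\<close>. For continuous \<open>\<beta>\<close> this amounts to convergence
  of the integral of \<open>1 / \<beta>\<close> over \<open>[\<alpha>\<^sub>0, \<infinity>)\<close>, and any other starting value beyond the zeros gives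
  the same answer.
\<close>

definition landau_pole :: "(real \<Rightarrow> real) \<Rightarrow> bool" where
  "landau_pole \<beta> \<longleftrightarrow>
     (\<exists>\<alpha>\<^sub>0 L\<^sub>0 L\<^sub>p a. \<alpha>\<^sub>0 > 0 \<and> (\<forall>\<alpha>\<ge>\<alpha>\<^sub>0. \<beta> \<alpha> \<noteq> 0) \<and> L\<^sub>p \<noteq> L\<^sub>0 \<and>
        running_coupling \<beta> L\<^sub>0 \<alpha>\<^sub>0 (closed_segment L\<^sub>0 L\<^sub>p - {L\<^sub>p}) a \<and>
        filterlim a at_top (at L\<^sub>p within closed_segment L\<^sub>0 L\<^sub>p))"

end

theory Submission
  imports Defs
begin

text \<open>
  Comparing the coefficients of \<open>L\<close> in the Callan--Symanzik equation gives
  \<open>2 \<gamma>\<^sub>2 = \<gamma> (\<alpha> \<gamma>' - \<gamma>)\<close>, so \<open>P = \<gamma>\<^sub>1 - 2 \<gamma>\<^sub>2 = \<gamma> (1 + \<gamma> - \<alpha> \<gamma>')\<close>. If \<open>P < 0\<close> for large \<open>\<alpha>\<close>, then \<open>\<gamma>\<close>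
  has no zeros there and is therefore positive, whence \<open>\<alpha> \<gamma>' > 1 + \<gamma>\<close>. So \<open>(1 + \<gamma>) / \<alpha>\<close> increases,
  \<open>\<beta> = \<alpha> \<gamma>\<close> grows at least quadratically, and the integral of \<open>1 / \<beta>\<close> converges. The necessary
  condition follows because \<open>P\<close>, being continuous with finitely many zeros, eventually has
  constant sign.
\<close>

section \<open>Power series near 0 and comparison of coefficients\<close>

text \<open>Induction on the index: the constant coefficient is the value at 0, and the derived
  series vanishes near 0 as well, its coefficient \<open>n\<close> being n + 1 times coefficient
  \<open>Suc n\<close> of \<open>F\<close>.\<close>

lemma eval_fps_eventually_zero_imp_zero:
  fixes F :: "'a::{real_normed_field,banach} fps"
  assumes "fps_conv_radius F > 0" "\<forall>\<^sub>F z in nhds 0. eval_fps F z = 0"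
  shows "F = 0"
proof -
  have "fps_nth F n = 0" for n
    using assms
  proof (induction n arbitrary: F)
    case 0
    then show ?case
      using eventually_nhds_x_imp_x[OF 0(2)] by (simp add: eval_fps_at_0)
  next
    case (Suc n)
    have r: "fps_conv_radius (fps_deriv F) > 0"
      using Suc.prems(1) fps_conv_radius_deriv[of F] by (rule less_le_trans)
    have "\<forall>\<^sub>F z in nhds 0. z \<in> eball 0 (fps_conv_radius F)"
      using Suc.prems(1) by (intro eventually_nhds_in_open) (auto simp: zero_ereal_def)
    \<comment> \<open>Differentiating at a point z near 0 requires vanishing on a whole
      neighbourhood of z, not just at z.\<close>
    moreover have "\<forall>\<^sub>F z in nhds 0. \<forall>\<^sub>F y in nhds z. eval_fps F y = 0"
      using Suc.prems(2) by (simp add: eventually_eventually)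
    ultimately have "\<forall>\<^sub>F z in nhds 0. eval_fps (fps_deriv F) z = 0"
    proof eventually_elim
      case (elim z)
      have "deriv (eval_fps F) z = deriv (\<lambda>_. 0) z"
        using elim(2) by (intro deriv_cong_ev) auto
      with elim(1) show ?case
        by (simp add: eval_fps_deriv)
    qed
    from Suc.IH[OF r this] show ?case
      by (simp del: of_nat_Suc)
  qed
  then show ?thesis
    by (simp add: fps_eq_iff)
qed

lemma has_fps_expansion_if_sums:
  fixes F :: "'a::{real_normed_field,banach} fps"
  assumes "\<forall>\<^sub>F z in nhds 0. (\<lambda>n. fps_nth F n * z ^ n) sums f z"
  shows "f has_fps_expansion F"
  unfolding has_fps_expansion_def
proof
  obtain e where e: "e > 0" "\<And>z. dist z 0 < e \<Longrightarrow> (\<lambda>n. fps_nth F n * z ^ n) sums f z"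
    using assms unfolding eventually_nhds_metric by auto
  \<comment> \<open>Convergence at the single nonzero point \<open>e / 2\<close> already bounds the
    radius from below.\<close>
  have "ereal (norm (of_real (e / 2) :: 'a)) \<le> fps_conv_radius F"
    unfolding fps_conv_radius_def
    using e by (intro conv_radius_geI sums_summable[OF e(2)]) (simp add: norm_divide)
  moreover have "0 < ereal (norm (of_real (e / 2) :: 'a))"
    using e(1) by (simp only: norm_of_real) simp
  ultimately show "fps_conv_radius F > 0"
    by (rule less_le_trans[rotated])
  show "\<forall>\<^sub>F z in nhds 0. eval_fps F z = f z"
    using assms by eventually_elim (simp add: eval_fps_def sums_iff)
qed

text \<open>The log expansions start at exponent 1; a zero constant term pads them, whatever the
  value of \<open>c 0\<close>.\<close>

lemma has_fps_expansion_if_sums_Suc: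
  fixes f :: "'a::{real_normed_field,banach} \<Rightarrow> 'a"
  assumes "\<forall>\<^sub>F z in nhds 0. (\<lambda>k. c (Suc k) * z ^ Suc k) sums f z"
  shows "f has_fps_expansion Abs_fps (\<lambda>n. if n = 0 then 0 else c n)"
proof (rule has_fps_expansion_if_sums)
  show "\<forall>\<^sub>F z in nhds 0. (\<lambda>n. fps_nth (Abs_fps (\<lambda>n. if n = 0 then 0 else c n)) n * z ^ n) sums f z"
    using assms
  proof eventually_elim
    case (elim z)
    then show ?case
      using sums_Suc_iff[of "\<lambda>n. (if n = 0 then 0 else c n) * z ^ n" "f z"] by simp
  qed
qed

section \<open>The recursion from the Callan-Symanzik equation\<close>

lemma log_coefficient_recursion:
  assumes expansion: "log_expansion G \<gamma>"
    and smooth: "smooth_log_expansion G \<gamma>"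
    and CS: "callan_symanzik G \<gamma>"
    and "\<alpha> > 0" "k \<ge> 1"
  shows "real (Suc k) * \<gamma> (Suc k) \<alpha> = \<gamma> 1 \<alpha> * (\<alpha> * deriv (\<gamma> k) \<alpha> - \<gamma> k \<alpha>)"
proof -
  define A where "A = Abs_fps (\<lambda>n. if n = 0 then 0 else \<gamma> n \<alpha>)"
  define D where "D = Abs_fps (\<lambda>n. if n = 0 then 0 else deriv (\<gamma> n) \<alpha>)"
  define b where "b = beta_function \<gamma> \<alpha>"
  define g where "g = \<gamma> 1 \<alpha>"
  \<comment> \<open>\<open>A\<close> expands 1 - G and \<open>D\<close> expands minus the
    \<alpha>-derivative of G, so \<open>H\<close> expands the left-hand side of the Callan-Symanzik
    equation.\<close>
  define H where "H = fps_deriv A - fps_const b * D - fps_const g * (1 - A)"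
  have A: "(\<lambda>L. 1 - G \<alpha> L) has_fps_expansion A"
    unfolding A_def using expansion \<open>\<alpha> > 0\<close>
    by (intro has_fps_expansion_if_sums_Suc) (simp add: log_expansion_def)
  have D: "(\<lambda>L. - deriv (\<lambda>a. G a L) \<alpha>) has_fps_expansion D"
    unfolding D_def
  proof (rule has_fps_expansion_if_sums_Suc)
    have "\<forall>\<^sub>F L in nhds 0. (\<lambda>a. G a L) field_differentiable at \<alpha> \<and>
        (\<lambda>k. deriv (\<gamma> (Suc k)) \<alpha> * L ^ Suc k) sums (- deriv (\<lambda>a. G a L) \<alpha>)"
      using smooth \<open>\<alpha> > 0\<close> unfolding smooth_log_expansion_def by blast
    then show "\<forall>\<^sub>F L in nhds 0. (\<lambda>k. deriv (\<gamma> (Suc k)) \<alpha> * L ^ Suc k) sums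
        (- deriv (\<lambda>a. G a L) \<alpha>)"
      by eventually_elim simp
  qed
  \<comment> \<open>Unlike the \<alpha>-derivative, whose expansion is assumed, the L-derivative can
    be taken termwise because the series is a power series in L.\<close>
  have A': "(\<lambda>L. - deriv (\<lambda>l. G \<alpha> l) L) has_fps_expansion fps_deriv A"
    unfolding has_fps_expansion_def
  proof
    have r: "fps_conv_radius A > 0"
      using A by (simp add: has_fps_expansion_def)
    show "fps_conv_radius (fps_deriv A) > 0"
      using r fps_conv_radius_deriv[of A] by (rule less_le_trans)
    have "\<forall>\<^sub>F z in nhds 0. z \<in> eball 0 (fps_conv_radius A)"
      using r by (intro eventually_nhds_in_open) (auto simp: zero_ereal_def)
    moreover have "\<forall>\<^sub>F z in nhds 0. \<forall>\<^sub>F y in nhds z. eval_fps A y = 1 - G \<alpha> y"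
      using A by (simp add: has_fps_expansion_def eventually_eventually)
    ultimately show "\<forall>\<^sub>F z in nhds 0. eval_fps (fps_deriv A) z = - deriv (\<lambda>l. G \<alpha> l) z"
    proof eventually_elim
      case (elim z)
      have "((\<lambda>y. 1 - eval_fps A y) has_field_derivative 0 - eval_fps (fps_deriv A) z) (at z)"
        using elim(1) by (intro derivative_intros has_field_derivative_eval_fps) auto
      then have "deriv (\<lambda>y. 1 - eval_fps A y) z = - eval_fps (fps_deriv A) z"
        by (simp add: DERIV_imp_deriv)
      moreover have "deriv (G \<alpha>) z = deriv (\<lambda>y. 1 - eval_fps A y) z"
        by (intro deriv_cong_ev refl eventually_mono[OF elim(2)]) simp
      ultimately show ?case
        by simp
    qed
  qed
  have H: "(\<lambda>L. - deriv (\<lambda>l. G \<alpha> l) L - b * (- deriv (\<lambda>a. G a L) \<alpha>) - g * (1 - (1 - G \<alpha> L)))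
      has_fps_expansion H"
    unfolding H_def by (intro fps_expansion_intros A A' D)
  have "\<forall>\<^sub>F L in nhds 0.
      - deriv (\<lambda>l. G \<alpha> l) L - b * (- deriv (\<lambda>a. G a L) \<alpha>) - g * (1 - (1 - G \<alpha> L)) = 0"
    using CS \<open>\<alpha> > 0\<close> by (simp add: callan_symanzik_def b_def g_def)
  with H[unfolded has_fps_expansion_def, THEN conjunct2]
  have "\<forall>\<^sub>F L in nhds 0. eval_fps H L = 0"
    by eventually_elim simp
  moreover have "fps_conv_radius H > 0"
    using H by (simp add: has_fps_expansion_def)
  ultimately have "H = 0"
    by (intro eval_fps_eventually_zero_imp_zero)
  then have "fps_nth H k = 0"
    by simp
  \<comment> \<open>For \<open>k \<ge> 1\<close> the constant 1 in \<open>1 - A\<close> does not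
    contribute; coefficient 0 would only say
    \<open>\<gamma> 1 \<alpha> = \<gamma> 1 \<alpha>\<close>.\<close>
  then show ?thesis
    using \<open>k \<ge> 1\<close>
    by (simp add: H_def A_def D_def b_def g_def beta_function_def algebra_simps del: of_nat_Suc)
qed

section \<open>Real analysis: constancy of sign, blow-up, growth\<close>

lemma continuous_nonzero_imp_pos:
  fixes f :: "real \<Rightarrow> real"
  assumes "continuous_on {a..} f" "\<And>x. x \<ge> a \<Longrightarrow> f x \<noteq> 0" "f a > 0" "x \<ge> a"
  shows "f x > 0"
proof (rule ccontr)
  assume "\<not> f x > 0"
  moreover have "continuous_on {a..x} f"
    using assms(1) by (rule continuous_on_subset) auto
  ultimately obtain y where "y \<ge> a" "f y = 0"
    using IVT2'[of f x 0 a] assms(3,4) by auto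
  with assms(2) show False
    by blast
qed

text \<open>Separation of variables: \<open>F\<close> measures the L-time needed to run from
  \<open>A\<close> to x, so its inverse \<open>a\<close> solves the flow equation. Comparison with
  the integral of 1 / (c x^2) bounds \<open>F\<close>, and its supremum is the pole.\<close>

lemma landau_pole_if_quadratic_growth:
  assumes cont: "continuous_on {A..} \<beta>" and "A > 0" "c > 0"
    and growth: "\<And>x. x \<ge> A \<Longrightarrow> c * x\<^sup>2 \<le> \<beta> x"
  shows "landau_pole \<beta>"
proof -
  have pos: "\<beta> x > 0" if "x \<ge> A" for x
  proof -
    have "0 < c * x\<^sup>2"
      using that \<open>A > 0\<close> \<open>c > 0\<close> by simp
    then show ?thesis
      using growth[OF that] by linarith
  qed
  define F where "F x = integral {A..x} (\<lambda>t. 1 / \<beta> t)" for x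
  have dF: "(F has_real_derivative 1 / \<beta> x) (at x)" if "x > A" for x
  proof -
    have "continuous_on {A..x + 1} (\<lambda>t. 1 / \<beta> t)"
      using pos by (intro continuous_intros continuous_on_subset[OF cont]) (auto simp: less_le)
    from integral_has_real_derivative[OF this, of x]
    have "(F has_real_derivative 1 / \<beta> x) (at x within {A..x + 1})"
      using that by (simp add: F_def[abs_def])
    then show ?thesis
      using that by (simp add: at_within_Icc_at)
  qed
  have mono: "F x < F y" if "A < x" "x < y" for x y
  proof (rule DERIV_pos_imp_increasing[OF \<open>x < y\<close>])
    fix t assume "x \<le> t" "t \<le> y"
    then show "\<exists>y. (F has_real_derivative y) (at t) \<and> 0 < y"
      using that dF[of t] pos[of t] by (intro exI[of _ "1 / \<beta> t"]) auto
  qed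
  have inj: "inj_on F {A<..}"
  proof (rule linorder_inj_onI)
    show "F x \<noteq> F y" if "x < y" "x \<in> {A<..}" "y \<in> {A<..}" for x y
      using mono[of x y] that by auto
  qed auto
  have cF: "continuous_on {A<..} F"
    using dF by (intro continuous_at_imp_continuous_on) (auto intro: DERIV_isCont)
  define a where "a = inv_into {A<..} F"
  have aF: "a (F x) = x" if "x > A" for x
    unfolding a_def using inj that by (intro inv_into_f_f) auto
  \<comment> \<open>Starting strictly beyond \<open>A\<close> makes \<open>F\<close> differentiable
    from both sides at the starting value.\<close>
  define x0 where "x0 = A + 1"
  have x0: "x0 > A" "x0 > 0"
    using \<open>A > 0\<close> by (auto simp: x0_def)
  have bound: "F x \<le> F x0 + 1 / (c * x0)" if "x \<ge> x0" for x
  proof -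
    \<comment> \<open>1 / (c x) is the tail integral of 1 / (c t^2), so the growth bound makes this
      sum nonincreasing.\<close>
    have "F x + 1 / (c * x) \<le> F x0 + 1 / (c * x0)"
    proof (rule DERIV_nonpos_imp_nonincreasing[OF that])
      fix t assume "x0 \<le> t" "t \<le> x"
      then have t: "t > A" "t > 0"
        using x0 by auto
      have "((\<lambda>x. F x + 1 / (c * x)) has_real_derivative 1 / \<beta> t - 1 / (c * t\<^sup>2)) (at t)"
        using t \<open>c > 0\<close>
        by (auto intro!: derivative_eq_intros dF simp: field_simps power2_eq_square)
      moreover have "1 / \<beta> t - 1 / (c * t\<^sup>2) \<le> 0"
        using growth[of t] pos[of t] t \<open>c > 0\<close> by (simp add: frac_le)
      ultimately show "\<exists>y. ((\<lambda>x. F x + 1 / (c * x)) has_real_derivative y) (at t) \<and> y \<le> 0"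
        by blast
    qed
    moreover have "1 / (c * x) > 0"
      using that x0 \<open>c > 0\<close> by simp
    ultimately show ?thesis
      by linarith
  qed
  define Lp where "Lp = Sup (F ` {x0..})"
  have bdd: "bdd_above (F ` {x0..})"
    using bound by (intro bdd_aboveI[of _ "F x0 + 1 / (c * x0)"]) auto
  have less_Lp: "F x < Lp" if "x > A" for x
  proof -
    have "F x < F (max (x + 1) x0)"
      using mono that by auto
    also have "\<dots> \<le> Lp"
      unfolding Lp_def by (intro cSup_upper[OF _ bdd]) auto
    finally show ?thesis .
  qed
  \<comment> \<open>Used twice: with \<open>y = x0\<close> it shows that \<open>a\<close> inverts
    \<open>F\<close> on the whole segment, with large \<open>y\<close> that \<open>a\<close>
    diverges at \<open>Lp\<close>.\<close>
  have onto: "\<exists>z\<ge>y. F z = L" if yL: "x0 \<le> y" "F y \<le> L" "L < Lp" for y L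
  proof -
    obtain w where w: "w \<ge> x0" "L < F w"
      using yL(3) bdd unfolding Lp_def by (subst (asm) less_cSup_iff) auto
    then have "y \<le> w"
      using mono[of w y] yL x0 by (cases "y \<le> w") auto
    moreover have "continuous_on {y..w} F"
      using yL x0 by (intro continuous_on_subset[OF cF]) auto
    ultimately show ?thesis
      using IVT'[of F y L w] yL w by auto
  qed
  have seg: "closed_segment (F x0) Lp = {F x0..Lp}"
    using less_Lp[OF x0(1)] by (simp add: closed_segment_eq_real_ivl)
  have "running_coupling \<beta> (F x0) x0 (closed_segment (F x0) Lp - {Lp}) a"
    unfolding running_coupling_def seg
  proof (intro conjI ballI)
    show "F x0 \<in> {F x0..Lp} - {Lp}"
      using less_Lp[OF x0(1)] by auto
    show "a (F x0) = x0"
      by (rule aF[OF x0(1)])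
  next
    fix L assume L: "L \<in> {F x0..Lp} - {Lp}"
    then obtain z where z: "z \<ge> x0" "F z = L"
      using onto[of x0 L] by force
    then have "z > A"
      using x0 by auto
    then have az: "a L = z"
      using aF z by blast
    then show "a L > 0"
      using z x0 by auto
    \<comment> \<open>Inverse function rule: the derivative of \<open>a\<close> is the reciprocal of
      1 / \<open>\<beta> z\<close>, which is the flow equation because
      \<open>a L = z\<close>.\<close>
    have "(a has_derivative (*) (\<beta> z)) (at (F z))"
    proof (rule has_derivative_inverse_strong[of "{A<..}" z F a "(*) (1 / \<beta> z)"])
      show "(F has_derivative (*) (1 / \<beta> z)) (at z)"
        using dF[OF \<open>z > A\<close>] by (simp add: has_field_derivative_def)
      show "(*) (1 / \<beta> z) \<circ> (*) (\<beta> z) = id"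
        using pos[of z] \<open>z > A\<close> by (auto simp: fun_eq_iff)
    qed (use \<open>z > A\<close> cF aF in auto)
    then have "(a has_real_derivative \<beta> (a L)) (at L)"
      using z az by (simp add: has_field_derivative_def)
    then show "(a has_real_derivative \<beta> (a L)) (at L within {F x0..Lp} - {Lp})"
      by (rule has_field_derivative_at_within)
  qed
  moreover have "filterlim a at_top (at Lp within closed_segment (F x0) Lp)"
    unfolding filterlim_at_top seg
  proof
    fix Z
    define y where "y = max Z x0"
    have y: "y \<ge> x0" "y > A" "y \<ge> Z"
      using x0 by (auto simp: y_def)
    show "\<forall>\<^sub>F L in at Lp within {F x0..Lp}. Z \<le> a L"
      unfolding eventually_at
    \<comment> \<open>Within this distance below \<open>Lp\<close>, L exceeds \<open>F y\<close>, so
      its preimage is at least \<open>y\<close>.\<close>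
    proof (intro exI[of _ "Lp - F y"] conjI ballI impI)
      show "Lp - F y > 0"
        using less_Lp[OF y(2)] by simp
      fix L assume L: "L \<in> {F x0..Lp}" "L \<noteq> Lp \<and> dist L Lp < Lp - F y"
      then have "F y \<le> L" "L < Lp"
        by (auto simp: dist_real_def)
      then obtain z where "z \<ge> y" "F z = L"
        using onto y by blast
      then show "Z \<le> a L"
        using aF[of z] y by auto
    qed
  qed
  moreover have "\<forall>\<alpha>\<ge>x0. \<beta> \<alpha> \<noteq> 0"
  proof (intro allI impI)
    fix \<alpha> assume "\<alpha> \<ge> x0"
    then show "\<beta> \<alpha> \<noteq> 0"
      using pos[of \<alpha>] x0 by simp
  qed
  moreover have "Lp \<noteq> F x0"
    using less_Lp[OF x0(1)] by simp
  ultimately show ?thesis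
    unfolding landau_pole_def using x0 by blast
qed

text \<open>The derivative of (1 + g x) / x is (x g' - (1 + g)) / x^2, which is nonnegative, so 1 +
  g grows at least linearly.\<close>

lemma linear_growth_if_superlinear_derivative:
  fixes g :: "real \<Rightarrow> real"
  assumes "A > 0"
    and diff: "\<And>x. x \<ge> A \<Longrightarrow> g field_differentiable at x"
    and pos: "g A > 0"
    and deriv: "\<And>x. x \<ge> A \<Longrightarrow> 1 + g x \<le> x * deriv g x"
  obtains B c where "B \<ge> A" "c > 0" "\<And>x. x \<ge> B \<Longrightarrow> c * x \<le> g x"
proof -
  \<comment> \<open>Half the slope (1 + g A) / A: the other half absorbs the summand 1 as soon as c
    x \<ge> 1, that is x \<ge> 1 / c.\<close>
  define c where "c = (1 + g A) / (2 * A)"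
  have "c > 0"
    using pos \<open>A > 0\<close> by (simp add: c_def)
  have "c * x \<le> g x" if "x \<ge> max A (1 / c)" for x
  proof -
    have x: "x \<ge> A" "c * x \<ge> 1"
      using that \<open>c > 0\<close> by (auto simp: field_simps)
    have "(1 + g A) / A \<le> (1 + g x) / x"
    proof (rule DERIV_nonneg_imp_nondecreasing[OF x(1)])
      fix t assume "A \<le> t" "t \<le> x"
      then have t: "t > 0" "(g has_real_derivative deriv g t) (at t)"
        using diff \<open>A > 0\<close> by (auto simp: field_differentiable_derivI)
      then have "((\<lambda>x. (1 + g x) / x) has_real_derivative
          (t * deriv g t - (1 + g t)) / t\<^sup>2) (at t)"
        by (auto intro!: derivative_eq_intros simp: field_simps power2_eq_square)
      moreover have "(t * deriv g t - (1 + g t)) / t\<^sup>2 \<ge> 0"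
        using deriv[OF \<open>A \<le> t\<close>] by simp
      ultimately show "\<exists>y. ((\<lambda>x. (1 + g x) / x) has_real_derivative y) (at t) \<and> 0 \<le> y"
        by blast
    qed
    moreover have "(1 + g A) / A = 2 * c"
      using \<open>A > 0\<close> by (simp add: c_def field_simps)
    ultimately have "2 * (c * x) \<le> 1 + g x"
      using x(1) \<open>A > 0\<close> by (simp add: field_simps)
    with x(2) show ?thesis
      by linarith
  qed
  with \<open>c > 0\<close> show ?thesis
    by (intro that[of "max A (1 / c)" c]) auto
qed

section \<open>The pole criterion and its contrapositive\<close>

theorem corollary2p4:
  fixes G :: "real \<Rightarrow> real \<Rightarrow> real" and \<gamma> :: "nat \<Rightarrow> real \<Rightarrow> real"
  assumes normalized: "\<forall>\<alpha>>0. G \<alpha> 0 = 1"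
    and expansion: "log_expansion G \<gamma>"
    and smooth: "smooth_log_expansion G \<gamma>"
    and CS: "callan_symanzik G \<gamma>"
    and beta_small: "\<forall>\<^sub>F \<alpha> in at_right 0. beta_function \<gamma> \<alpha> > 0"
    and P_small: "\<forall>\<^sub>F \<alpha> in at_right 0. \<gamma> 1 \<alpha> - 2 * \<gamma> 2 \<alpha> > 0"
    and P_zeros: "finite {\<alpha>. \<alpha> > 0 \<and> \<gamma> 1 \<alpha> - 2 * \<gamma> 2 \<alpha> = 0}"
    and beta_large: "\<not> (\<forall>\<^sub>F \<alpha> in at_top. beta_function \<gamma> \<alpha> < 0)"
  shows "((\<forall>\<^sub>F \<alpha> in at_top. \<gamma> 1 \<alpha> < 2 * \<gamma> 2 \<alpha>) \<longrightarrow> landau_pole (beta_function \<gamma>)) \<and>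
         (\<not> landau_pole (beta_function \<gamma>) \<longrightarrow> (\<forall>\<^sub>F \<alpha> in at_top. \<gamma> 1 \<alpha> \<ge> 2 * \<gamma> 2 \<alpha>))"
proof -
  let ?P = "\<lambda>\<alpha>. \<gamma> 1 \<alpha> - 2 * \<gamma> 2 \<alpha>"
  have diff: "\<gamma> k field_differentiable at \<alpha>" if "k \<ge> 1" "\<alpha> > 0" for k \<alpha>
    using smooth that by (simp add: smooth_log_expansion_def)
  have cont: "continuous_on {A..} (\<gamma> k)" if "k \<ge> 1" "A > 0" for k A
    using diff that
    by (intro continuous_at_imp_continuous_on) (auto intro: field_differentiable_imp_continuous_at)
  have P: "?P \<alpha> = \<gamma> 1 \<alpha> * (1 + \<gamma> 1 \<alpha> - \<alpha> * deriv (\<gamma> 1) \<alpha>)" if "\<alpha> > 0" for \<alpha>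
    using log_coefficient_recursion[OF expansion smooth CS that, of 1]
    by (simp add: algebra_simps numeral_2_eq_2)
  have pole: "landau_pole (beta_function \<gamma>)" if less: "\<forall>\<^sub>F \<alpha> in at_top. \<gamma> 1 \<alpha> < 2 * \<gamma> 2 \<alpha>"
  proof -
    obtain A0 where A0: "\<And>\<alpha>. \<alpha> \<ge> A0 \<Longrightarrow> \<gamma> 1 \<alpha> < 2 * \<gamma> 2 \<alpha>"
      using less by (auto simp: eventually_at_top_linorder)
    \<comment> \<open>\<open>beta_large\<close> gives nonnegative values of \<beta> only at some
      arbitrarily large couplings. One such point beyond \<open>A0\<close> suffices: \<gamma> has no
      zeros from there on, so its sign at \<open>A\<close> persists.\<close>
    obtain A where A: "A \<ge> max A0 1" "beta_function \<gamma> A \<ge> 0"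
      using beta_large unfolding eventually_at_top_linorder not_less[symmetric] by blast
    have neg: "\<gamma> 1 \<alpha> * (1 + \<gamma> 1 \<alpha> - \<alpha> * deriv (\<gamma> 1) \<alpha>) < 0" if "\<alpha> \<ge> A" for \<alpha>
      using A0[of \<alpha>] P[of \<alpha>] that A by auto
    then have nz: "\<gamma> 1 \<alpha> \<noteq> 0" if "\<alpha> \<ge> A" for \<alpha>
      using that by fastforce
    have "\<gamma> 1 A > 0"
      using A nz[of A] by (auto simp: beta_function_def zero_le_mult_iff)
    moreover have "continuous_on {A..} (\<gamma> 1)"
      using A by (intro cont) auto
    ultimately have pos: "\<gamma> 1 \<alpha> > 0" if "\<alpha> \<ge> A" for \<alpha>
      using continuous_nonzero_imp_pos[of A "\<gamma> 1" \<alpha>] nz that by blast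
    have deriv: "1 + \<gamma> 1 \<alpha> \<le> \<alpha> * deriv (\<gamma> 1) \<alpha>" if "\<alpha> \<ge> A" for \<alpha>
      using neg[OF that] pos[OF that] by (simp add: mult_less_0_iff)
    have "A > 0"
      using A by auto
    moreover have "\<gamma> 1 field_differentiable at \<alpha>" if "\<alpha> \<ge> A" for \<alpha>
      using diff that A by auto
    ultimately obtain B c where B: "B \<ge> A" "c > 0" "\<And>x. x \<ge> B \<Longrightarrow> c * x \<le> \<gamma> 1 x"
      using linear_growth_if_superlinear_derivative[of A "\<gamma> 1"] pos[of A] deriv by blast
    show ?thesis
    proof (rule landau_pole_if_quadratic_growth)
      show "B > 0"
        using A B by auto
      then show "continuous_on {B..} (beta_function \<gamma>)"
        unfolding beta_function_def by (intro continuous_intros cont) auto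
      show "c * x\<^sup>2 \<le> beta_function \<gamma> x" if "x \<ge> B" for x
        using mult_left_mono[OF B(3)[OF that], of x] that \<open>B > 0\<close>
        by (simp add: beta_function_def power2_eq_square algebra_simps)
    qed (rule B(2))
  qed
  obtain M where M: "\<And>\<alpha>. \<alpha> \<in> {\<alpha>. \<alpha> > 0 \<and> ?P \<alpha> = 0} \<Longrightarrow> \<alpha> \<le> M"
    using P_zeros by (meson bdd_above_finite bdd_above.E)
  define A where "A = max M 0 + 1"
  have "A > 0"
    by (simp add: A_def)
  have nz: "?P \<alpha> \<noteq> 0" if "\<alpha> \<ge> A" for \<alpha>
  proof
    assume "?P \<alpha> = 0"
    moreover have "\<alpha> > 0" "\<alpha> > M"
      using that by (auto simp: A_def)
    ultimately show False
      using M[of \<alpha>] by simp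
  qed
  have contP: "continuous_on {A..} ?P"
    using \<open>A > 0\<close> by (intro continuous_intros cont) auto
  \<comment> \<open>The contrapositive needs this dichotomy: failure of "eventually \<ge>" alone
    gives the strict inequality only at arbitrarily large couplings. Beyond its last zero P keeps
    its sign, so it then holds eventually.\<close>
  have "(\<forall>\<^sub>F \<alpha> in at_top. \<gamma> 1 \<alpha> \<ge> 2 * \<gamma> 2 \<alpha>) \<or> (\<forall>\<^sub>F \<alpha> in at_top. \<gamma> 1 \<alpha> < 2 * \<gamma> 2 \<alpha>)"
  proof (cases "?P A > 0")
    case True
    then have "?P \<alpha> > 0" if "\<alpha> \<ge> A" for \<alpha>
      using continuous_nonzero_imp_pos[OF contP nz] that by blast
    then show ?thesis
      unfolding eventually_at_top_linorder by (intro disjI1 exI[of _ A]) force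
  next
    case False
    then have "- ?P A > 0"
      using nz[of A] by simp
    moreover have "continuous_on {A..} (\<lambda>\<alpha>. - ?P \<alpha>)"
      by (intro continuous_intros contP)
    moreover have "- ?P \<alpha> \<noteq> 0" if "\<alpha> \<ge> A" for \<alpha>
      using nz[OF that] by simp
    ultimately have "- ?P \<alpha> > 0" if "\<alpha> \<ge> A" for \<alpha>
      using continuous_nonzero_imp_pos[of A "\<lambda>\<alpha>. - ?P \<alpha>" \<alpha>] that by blast
    then show ?thesis
      unfolding eventually_at_top_linorder by (intro disjI2 exI[of _ A]) force
  qed
  with pole show ?thesis
    by blast
qed

end
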